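(* Let $n,d$ be integers with $2\le d\le n-1$, let $T$ be a tree with order $n$ and diameter $d$, and let $k\in\{2,3,\ldots,n-1\}$. Then $$SW_k(T)\geq SW_k(\mathbf{T}_{d,n}).$$ If $k\leq n-\lceil\frac{d}{2}\rceil$, then equality implies that $T=\mathbf{T}_{d,n}$.
   Context: For trees, $T_1=T_2$ means that $T_1$ and $T_2$ are isomorphic. For a connected graph $G$ and a nonempty set $A\subseteq V(G)$, the Steiner distance $d(A)$ is the minimum number of edges in a subtree of $G$ whose vertex set contains $A$. The $k$-Steiner Wiener index is $SW_k(G)=\sum_{A\subseteq V(G),\,|A|=k} d(A)$. For integers $2\le d\le n-1$, $\mathbf{T}_{d,n}$ is the tree obtained by attaching $n-d-1$ pendent edges to a centre vertex of the path of order $d+1$. *)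

theory Defs
  imports Complex_Main
begin

(* A graph is a pair of a vertex set and a set of unordered edges. *)
type_synonym 'a graph = "'a set \<times> 'a set set"

abbreviation verts :: "'a graph \<Rightarrow> 'a set" where
  "verts G \<equiv> fst G"

abbreviation edges :: "'a graph \<Rightarrow> 'a set set" where
  "edges G \<equiv> snd G"

definition simple_graph :: "'a graph \<Rightarrow> bool" where
  "simple_graph G \<longleftrightarrow> finite (verts G) \<and> (\<forall>e \<in> edges G. e \<subseteq> verts G \<and> card e = 2)"

definition walk :: "'a graph \<Rightarrow> 'a list \<Rightarrow> bool" where
  "walk G xs \<longleftrightarrow>
     xs \<noteq> [] \<and> set xs \<subseteq> verts G \<and> successively (\<lambda>u v. {u, v} \<in> edges G) xs"

definition connected_graph :: "'a graph \<Rightarrow> bool" where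
  "connected_graph G \<longleftrightarrow> verts G \<noteq> {} \<and>
     (\<forall>u \<in> verts G. \<forall>v \<in> verts G. \<exists>xs. walk G xs \<and> hd xs = u \<and> last xs = v)"

(* The first vertex of the cycle is not repeated at the end of the list. *)
definition cycle :: "'a graph \<Rightarrow> 'a list \<Rightarrow> bool" where
  "cycle G xs \<longleftrightarrow>
     walk G xs \<and> distinct xs \<and> 3 \<le> length xs \<and> {last xs, hd xs} \<in> edges G"

definition tree :: "'a graph \<Rightarrow> bool" where
  "tree G \<longleftrightarrow> simple_graph G \<and> connected_graph G \<and> (\<nexists>xs. cycle G xs)"

definition subtree :: "'a graph \<Rightarrow> 'a graph \<Rightarrow> bool" where
  "subtree S G \<longleftrightarrow> tree S \<and> verts S \<subseteq> verts G \<and> edges S \<subseteq> edges G"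

definition isomorphic :: "'a graph \<Rightarrow> 'b graph \<Rightarrow> bool" where
  "isomorphic G H \<longleftrightarrow>
     (\<exists>f. bij_betw f (verts G) (verts H) \<and>
        (\<forall>u \<in> verts G. \<forall>v \<in> verts G. {u, v} \<in> edges G \<longleftrightarrow> {f u, f v} \<in> edges H))"

(* Only meaningful if some walk joins u and v, as in a connected graph. *)
definition graph_dist :: "'a graph \<Rightarrow> 'a \<Rightarrow> 'a \<Rightarrow> nat" where
  "graph_dist G u v =
     (LEAST m. \<exists>xs. walk G xs \<and> hd xs = u \<and> last xs = v \<and> length xs = m + 1)"

definition eccentricity :: "'a graph \<Rightarrow> 'a \<Rightarrow> nat" where
  "eccentricity G u = Max (graph_dist G u ` verts G)"

definition graph_diameter :: "'a graph \<Rightarrow> nat" where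
  "graph_diameter G = Max (eccentricity G ` verts G)"

definition centre :: "'a graph \<Rightarrow> 'a set" where
  "centre G = {c \<in> verts G. \<forall>v \<in> verts G. eccentricity G c \<le> eccentricity G v}"

definition steiner_dist :: "'a graph \<Rightarrow> 'a set \<Rightarrow> nat" where
  "steiner_dist G A = (LEAST m. \<exists>S. subtree S G \<and> A \<subseteq> verts S \<and> card (edges S) = m)"

definition steiner_wiener :: "nat \<Rightarrow> 'a graph \<Rightarrow> nat" where
  "steiner_wiener k G = (\<Sum>A | A \<subseteq> verts G \<and> card A = k. steiner_dist G A)"

(* The path of order d + 1, with d edges. *)
definition path_graph :: "nat \<Rightarrow> nat graph" where
  "path_graph d = ({0..d}, {{i, i + 1} | i. i < d})"

(* The tree T_{d,n}, for c a centre vertex of the path with d edges: the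
   pendent vertices d + 1, ..., n - 1 are attached at c. If d is odd the path
   has two centre vertices, and both choices of c give isomorphic trees. *)
definition T_graph :: "nat \<Rightarrow> nat \<Rightarrow> nat \<Rightarrow> nat graph" where
  "T_graph d n c =
     (verts (path_graph d) \<union> {d<..<n},
      edges (path_graph d) \<union> {{c, j} | j. j \<in> {d<..<n}})"

end

theory Submission
  imports Defs
begin

text \<open>
A \<open>k\<close>-set of vertices of a tree is spanned by a unique smallest subtree, whose edges are those
that separate the set (\<open>steiner_dist_eq_cuts\<close>). Summing over all \<open>k\<close>-sets and exchanging the sums, the
\<open>k\<close>-Steiner Wiener index becomes a sum over the edges, in which an edge with \<open>s\<close> vertices on one side
contributes the number \<open>(n choose k) - (s choose k) - ((n - s) choose k)\<close> of \<open>k\<close>-sets that it separates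
(\<open>steiner_wiener_eq_cut_counts\<close>). By convexity of binomial coefficients this number grows with the size
of the smaller side (\<open>cut_count_mono\<close>).

A tree of diameter \<open>d\<close> contains a path with \<open>d\<close> edges. The edge from position \<open>i\<close> to \<open>i + 1\<close> of this path has at least
\<open>i + 1\<close> vertices on one side and at least \<open>d - i\<close> on the other, and every other edge has at least one
vertex on each side. This bounds all contributions from below (\<open>steiner_wiener_lower_bound\<close>), and if the
remaining vertices are pendent vertices at a centre vertex of the path, all these bounds are attained at
the same time (\<open>steiner_wiener_T_graph\<close>).

If \<open>k\<close> is at most \<open>n - m\<close>, the contribution of a side with \<open>m\<close> vertices is strictly smaller than that of any more
balanced split (\<open>cut_count_strict_mono\<close>). The largest \<open>m\<close> that occurs is \<open>d / 2\<close> rounded up, which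
explains the bound on \<open>k\<close>. Under this bound equality determines the two sides of every edge:
nothing branches off the path away from its middle, and all edges outside the path are pendent. Hence they are
all attached to one central vertex (\<open>extremal_pendants_at\<close>, \<open>pendants_atI\<close>).

Trees are handled through their edge cuts rather than through walks: a graph is a tree if every
proper nonempty set of vertices is left by an edge, and every edge is the only one leaving some set
(\<open>tree_iff_cuts\<close>).\<close>

section \<open>Trees in terms of edge cuts\<close>

text \<open>Here \<open>B\<close> is an edge or a set of terminals; in both cases the two parts of the vertex set are
\<open>X\<close> and its complement.\<close>

definition splits :: "'a set \<Rightarrow> 'a set \<Rightarrow> bool" where
  "splits X B \<longleftrightarrow> B \<inter> X \<noteq> {} \<and> B - X \<noteq> {}"

text \<open>In a connected graph, \<open>X\<close> is one of the two vertex classes left after the deletion of the bridge \<open>e\<close>.\<close>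

definition edge_cut :: "'a graph \<Rightarrow> 'a set \<Rightarrow> 'a set \<Rightarrow> bool" where
  "edge_cut G e X \<longleftrightarrow> X \<subseteq> verts G \<and> {e' \<in> edges G. splits X e'} = {e}"

lemma splits_doubleton:
  "splits X {u, v} \<longleftrightarrow> (u \<in> X \<and> v \<notin> X) \<or> (v \<in> X \<and> u \<notin> X)"
  by (auto simp: splits_def)

lemma splits_Diff: "B \<subseteq> V \<Longrightarrow> splits (V - X) B \<longleftrightarrow> splits X B"
  by (auto simp: splits_def)

lemma edge_subset: "simple_graph G \<Longrightarrow> e \<in> edges G \<Longrightarrow> e \<subseteq> verts G"
  by (auto simp: simple_graph_def)

lemma edge_doubleton:
  assumes "simple_graph G" "e \<in> edges G"
  obtains u v where "e = {u, v}" "u \<noteq> v" "u \<in> verts G" "v \<in> verts G"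
  using assms by (auto simp: simple_graph_def card_2_iff dest!: bspec)

lemma finite_edges: "simple_graph G \<Longrightarrow> finite (edges G)"
  by (rule finite_subset[of _ "Pow (verts G)"]) (auto simp: simple_graph_def)

lemma cut_Diff:
  assumes "simple_graph G" "edge_cut G e X"
  shows "edge_cut G e (verts G - X)"
proof -
  have "{e' \<in> edges G. splits (verts G - X) e'} = {e' \<in> edges G. splits X e'}"
    using edge_subset[OF assms(1)] splits_Diff by blast
  then show ?thesis using assms(2) by (auto simp: edge_cut_def)
qed

lemma cut_splits: "edge_cut G e X \<Longrightarrow> e' \<in> edges G \<Longrightarrow> splits X e' \<longleftrightarrow> e' = e"
  by (auto simp: edge_cut_def)

lemma list_leaves_set:
  assumes "xs \<noteq> []" "hd xs \<in> X" "last xs \<notin> X"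
  shows "\<exists>i. Suc i < length xs \<and> xs ! i \<in> X \<and> xs ! Suc i \<notin> X"
  using assms
proof (induction xs)
  case (Cons x xs)
  show ?case
  proof (cases "xs \<noteq> [] \<and> hd xs \<in> X")
    case True
    then obtain i where "Suc i < length xs" "xs ! i \<in> X" "xs ! Suc i \<notin> X"
      using Cons by auto
    then show ?thesis by (intro exI[of _ "Suc i"]) auto
  next
    case False
    then show ?thesis using Cons.prems by (intro exI[of _ 0]) (cases xs; auto)
  qed
qed simp

lemma walk_edge: "walk G xs \<Longrightarrow> Suc i < length xs \<Longrightarrow> {xs ! i, xs ! Suc i} \<in> edges G"
  by (auto simp: walk_def successively_conv_nth)

lemma walk_append_edge:
  assumes "walk G xs" "{last xs, v} \<in> edges G" "v \<in> verts G"
  shows "walk G (xs @ [v])"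
  using assms by (auto simp: walk_def successively_append_iff)

text \<open>The closed part between two visits to the same vertex could be cut out of the walk.\<close>

lemma shortest_walk_distinct:
  assumes "walk G xs"
    and "\<And>ys. walk G ys \<Longrightarrow> hd ys = hd xs \<Longrightarrow> last ys = last xs \<Longrightarrow> length xs \<le> length ys"
  shows "distinct xs"
proof (rule ccontr)
  assume "\<not> distinct xs"
  then obtain as bs cs y where xs: "xs = as @ [y] @ bs @ [y] @ cs"
    using not_distinct_decomp by blast
  have "walk G (as @ [y] @ cs)"
    using assms(1) unfolding xs walk_def
    by (auto simp: successively_append_iff successively_Cons)
  moreover have "hd (as @ [y] @ cs) = hd xs" "last (as @ [y] @ cs) = last xs"
    unfolding xs by (cases as; auto)+
  ultimately show False using assms(2) unfolding xs by fastforce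
qed

lemma obtain_shortest_walk:
  assumes "walk G zs"
  obtains xs where "walk G xs" "hd xs = hd zs" "last xs = last zs" "distinct xs"
    "\<And>ys. walk G ys \<Longrightarrow> hd ys = hd zs \<Longrightarrow> last ys = last zs \<Longrightarrow> length xs \<le> length ys"
proof -
  define P where "P ys \<longleftrightarrow> walk G ys \<and> hd ys = hd zs \<and> last ys = last zs" for ys
  have "P zs" using assms by (simp add: P_def)
  then obtain xs where xs: "P xs" "\<And>ys. P ys \<Longrightarrow> length xs \<le> length ys"
    using ex_has_least_nat[of P zs length] by blast
  then show thesis
    using that[of xs] shortest_walk_distinct[of G xs] by (auto simp: P_def)
qed

text \<open>In one direction, a walk from \<open>X\<close> to its complement has to use an edge that leaves \<open>X\<close>. In the other,
the set of vertices that can be reached from \<open>u\<close> is left by no edge.\<close>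

lemma connected_iff_splits:
  assumes "simple_graph G"
  shows "connected_graph G \<longleftrightarrow> verts G \<noteq> {} \<and>
    (\<forall>X \<subseteq> verts G. X \<noteq> {} \<longrightarrow> X \<noteq> verts G \<longrightarrow> (\<exists>e \<in> edges G. splits X e))"
    (is "?L \<longleftrightarrow> ?R")
proof
  assume L: ?L
  have "\<exists>e \<in> edges G. splits X e" if "X \<subseteq> verts G" "X \<noteq> {}" "X \<noteq> verts G" for X
  proof -
    obtain u v where "u \<in> X" "v \<in> verts G - X" using \<open>X \<subseteq> verts G\<close> \<open>X \<noteq> {}\<close> \<open>X \<noteq> verts G\<close> by blast
    then obtain xs where "walk G xs" "hd xs = u" "last xs = v"
      using L \<open>X \<subseteq> verts G\<close> unfolding connected_graph_def by blast
    with \<open>u \<in> X\<close> \<open>v \<in> verts G - X\<close>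
    have xs: "walk G xs" "hd xs \<in> X" "last xs \<notin> X" by auto
    then have "xs \<noteq> []" by (simp add: walk_def)
    then obtain i where "Suc i < length xs" "xs ! i \<in> X" "xs ! Suc i \<notin> X"
      using list_leaves_set[of xs X] xs by blast
    then show ?thesis using walk_edge[OF xs(1), of i]
      by (intro bexI[of _ "{xs ! i, xs ! Suc i}"]) (auto simp: splits_doubleton)
  qed
  then show ?R using L by (auto simp: connected_graph_def)
next
  assume R: ?R
  have "\<exists>xs. walk G xs \<and> hd xs = u \<and> last xs = v" if u: "u \<in> verts G" and v: "v \<in> verts G" for u v
  proof -
    define X where "X = {w \<in> verts G. \<exists>xs. walk G xs \<and> hd xs = u \<and> last xs = w}"
    have "walk G [u]" using u by (simp add: walk_def)
    then have "u \<in> X" using u unfolding X_def by force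
    moreover have "\<not> splits X e" if e: "e \<in> edges G" for e
    proof
      assume "splits X e"
      moreover obtain a b where ab: "e = {a, b}" using edge_doubleton[OF assms e] by metis
      ultimately obtain a b where ab: "e = {a, b}" "a \<in> X" "b \<notin> X"
        by (auto simp: splits_doubleton)
      obtain xs where xs: "walk G xs" "hd xs = u" "last xs = a" using ab by (auto simp: X_def)
      have b: "b \<in> verts G" using edge_subset[OF assms e] ab by auto
      have "walk G (xs @ [b])" using walk_append_edge[OF xs(1)] xs ab e b by auto
      moreover have "hd (xs @ [b]) = u" using xs by (auto simp: walk_def)
      ultimately have "b \<in> X" using b unfolding X_def by force
      then show False using ab by blast
    qed
    moreover have "X \<subseteq> verts G" by (auto simp: X_def)
    ultimately have "X = verts G" using R by blast
    then show ?thesis using v by (auto simp: X_def)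
  qed
  then show ?L using R by (auto simp: connected_graph_def)
qed

text \<open>The cut consists of the vertices that can still be reached from one end of \<open>e\<close> when \<open>e\<close> is deleted.
It misses the other end: a shortest walk between the two ends would close up with \<open>e\<close> to a cycle.\<close>

lemma bridge_cut:
  assumes G: "simple_graph G" and acyc: "\<nexists>xs. cycle G xs" and e: "e \<in> edges G"
  shows "\<exists>X. edge_cut G e X"
proof -
  obtain u v where uv: "e = {u, v}" "u \<noteq> v" "u \<in> verts G" "v \<in> verts G"
    using edge_doubleton[OF G e] by metis
  define H where "H = (verts G, edges G - {e})"
  define X where "X = {w \<in> verts G. \<exists>xs. walk H xs \<and> hd xs = u \<and> last xs = w}"
  have "walk H [u]" using uv by (simp add: walk_def H_def)
  then have uX: "u \<in> X" using uv unfolding X_def by force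
  have vX: "v \<notin> X"
  proof
    assume "v \<in> X"
    then obtain zs where "walk H zs" "hd zs = u" "last zs = v" by (auto simp: X_def)
    then obtain xs where xs: "walk H xs" "hd xs = u" "last xs = v" "distinct xs"
      using obtain_shortest_walk[of H zs] by metis
    have "walk G xs" using xs(1) by (auto simp: walk_def H_def elim: successively_mono)
    moreover have "3 \<le> length xs"
    proof (rule ccontr)
      assume "\<not> 3 \<le> length xs"
      then consider "xs = []" | a where "xs = [a]" | a b where "xs = [a, b]"
        by (cases xs; cases "tl xs"; cases "tl (tl xs)") auto
      then show False
        using xs uv by cases (auto simp: walk_def H_def)
    qed
    moreover have "{last xs, hd xs} \<in> edges G" using xs uv e by (simp add: insert_commute)
    ultimately show False using acyc xs(4) by (auto simp: cycle_def)
  qed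
  have "\<not> splits X f" if f: "f \<in> edges G" "f \<noteq> e" for f
  proof
    assume "splits X f"
    moreover obtain a b where ab: "f = {a, b}" using edge_doubleton[OF G f(1)] by metis
    ultimately obtain a b where ab: "f = {a, b}" "a \<in> X" "b \<notin> X"
      by (auto simp: splits_doubleton)
    obtain xs where xs: "walk H xs" "hd xs = u" "last xs = a" using ab by (auto simp: X_def)
    have b: "b \<in> verts G" using edge_subset[OF G f(1)] ab by auto
    have "walk H (xs @ [b])" using walk_append_edge[OF xs(1)] xs ab f b by (auto simp: H_def)
    moreover have "hd (xs @ [b]) = u" using xs by (auto simp: walk_def)
    ultimately have "b \<in> X" using b unfolding X_def by force
    then show False using ab by blast
  qed
  then have "edge_cut G e X"
    using uX vX e uv unfolding edge_cut_def by (auto simp: splits_doubleton X_def)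
  then show ?thesis ..
qed

text \<open>A cycle that starts on one side of the cut of its closing edge has to cross that cut a second time,
and would have to use the closing edge twice.\<close>

lemma no_cycle_if_cuts:
  assumes "\<And>e. e \<in> edges G \<Longrightarrow> \<exists>X. edge_cut G e X"
  shows "\<nexists>xs. cycle G xs"
proof
  assume "\<exists>xs. cycle G xs"
  then obtain xs where xs: "walk G xs" "distinct xs" "3 \<le> length xs" "{last xs, hd xs} \<in> edges G"
    by (auto simp: cycle_def)
  obtain X where X: "edge_cut G {last xs, hd xs} X" using assms xs by blast
  have ne: "xs \<noteq> []" using xs by auto
  have ends: "hd xs = xs ! 0" "last xs = xs ! (length xs - 1)"
    using ne by (simp_all add: hd_conv_nth last_conv_nth)
  \<comment> \<open>Orient the cut so that the walk along the cycle starts inside it.\<close>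
  define Y where "Y = (if hd xs \<in> X then X else - X)"
  have YX: "splits Y {a, b} \<longleftrightarrow> splits X {a, b}" for a b
    by (auto simp: Y_def splits_doubleton)
  have "splits X {last xs, hd xs}" using X xs(4) by (simp add: cut_splits)
  then have "hd xs \<in> Y" "last xs \<notin> Y" by (auto simp: Y_def splits_doubleton)
  then obtain i where i: "Suc i < length xs" "xs ! i \<in> Y" "xs ! Suc i \<notin> Y"
    using list_leaves_set[OF ne] by blast
  then have "splits X {xs ! i, xs ! Suc i}" using YX by (auto simp: splits_doubleton)
  then have "{xs ! i, xs ! Suc i} = {xs ! (length xs - 1), xs ! 0}"
    using walk_edge[OF xs(1) i(1)] X ends by (simp add: cut_splits)
  moreover have "xs ! i \<noteq> xs ! 0 \<or> xs ! Suc i \<noteq> xs ! (length xs - 1)"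
    using xs(2,3) i(1) ne by (auto simp: nth_eq_iff_index_eq)
  moreover have "xs ! Suc i \<noteq> xs ! 0" using xs(2) i(1) ne by (auto simp: nth_eq_iff_index_eq)
  ultimately show False by (auto simp: doubleton_eq_iff)
qed

text \<open>This characterization replaces walks and cycles in all that follows: connectedness says that every
proper nonempty set of vertices is left by an edge, acyclicity that every edge is the only one
to leave some set.\<close>

lemma tree_iff_cuts:
  "tree G \<longleftrightarrow> simple_graph G \<and> verts G \<noteq> {} \<and>
    (\<forall>X \<subseteq> verts G. X \<noteq> {} \<longrightarrow> X \<noteq> verts G \<longrightarrow> (\<exists>e \<in> edges G. splits X e)) \<and>
    (\<forall>e \<in> edges G. \<exists>X. edge_cut G e X)"
proof (cases "simple_graph G")
  case True
  then have "(\<nexists>xs. cycle G xs) \<longleftrightarrow> (\<forall>e \<in> edges G. \<exists>X. edge_cut G e X)"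
    using bridge_cut[of G] no_cycle_if_cuts[of G] by metis
  then show ?thesis unfolding tree_def connected_iff_splits[OF True] by simp
qed (simp add: tree_def)

lemma tree_simple: "tree G \<Longrightarrow> simple_graph G"
  by (simp add: tree_def)

lemma tree_splits:
  "tree G \<Longrightarrow> X \<subseteq> verts G \<Longrightarrow> X \<noteq> {} \<Longrightarrow> X \<noteq> verts G \<Longrightarrow> \<exists>e \<in> edges G. splits X e"
  by (simp add: tree_iff_cuts)

lemma tree_edge_cut: "tree G \<Longrightarrow> e \<in> edges G \<Longrightarrow> \<exists>X. edge_cut G e X"
  by (simp add: tree_iff_cuts)

text \<open>A cut may be replaced by its complement, so the classes can be chosen to contain a given root.\<close>

lemma rooted_edge_cuts:
  assumes G: "tree G" and r: "r \<in> verts G"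
  obtains side where "\<And>e. e \<in> edges G \<Longrightarrow> edge_cut G e (side e) \<and> r \<in> side e"
proof -
  have "\<exists>X. edge_cut G e X \<and> r \<in> X" if e: "e \<in> edges G" for e
  proof -
    obtain X where X: "edge_cut G e X" using tree_edge_cut[OF G e] by blast
    then show ?thesis
      using cut_Diff[OF tree_simple[OF G] X] r by (cases "r \<in> X") auto
  qed
  then show thesis using that by metis
qed

section \<open>Steiner distance as a number of separating edges\<close>

text \<open>Deleting an edge of a tree leaves a tree on either side. For connectedness, a set \<open>Y\<close> on the side \<open>X\<close>
that avoids the end \<open>u\<close> of the deleted edge is left by an edge of \<open>S\<close>, and this edge stays inside \<open>X\<close>
because only \<open>e\<close> leaves \<open>X\<close>; a set that contains \<open>u\<close> is replaced by its complement.\<close>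

lemma subtree_one_side:
  assumes S: "tree S" and cut: "edge_cut S e X" and e: "e \<in> edges S"
    and ne: "verts S \<inter> X \<noteq> {}"
  shows "tree (verts S \<inter> X, {f \<in> edges S. f \<subseteq> X})" (is "tree ?S'")
proof -
  have sS: "simple_graph S" using S by (rule tree_simple)
  have simple: "simple_graph ?S'" using sS by (auto simp: simple_graph_def)
  obtain u w where uw: "e = {u, w}" "u \<in> X" "w \<notin> X"
  proof -
    have "splits X e" using cut e by (simp add: cut_splits)
    then show thesis using edge_doubleton[OF sS e] that
      by (metis splits_doubleton insert_commute)
  qed
  have conn: "\<exists>f \<in> edges ?S'. splits Y f"
    if Y: "Y \<subseteq> verts ?S'" "Y \<noteq> {}" "Y \<noteq> verts ?S'" for Y
  proof -
    have *: "\<exists>f \<in> edges ?S'. splits Y f"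
      if Y: "Y \<subseteq> verts ?S'" "Y \<noteq> {}" "u \<notin> Y" for Y
    proof -
      have "Y \<noteq> verts S" using Y uw e edge_subset[OF sS e] by auto
      then obtain f where f: "f \<in> edges S" "splits Y f"
        using tree_splits[OF S, of Y] Y by auto
      have "f \<subseteq> X"
      proof (rule ccontr)
        assume "\<not> f \<subseteq> X"
        then have "splits X f" using f(2) Y by (auto simp: splits_def)
        then have "f = e" using cut f by (simp add: cut_splits)
        then show False using f(2) Y uw by (auto simp: splits_doubleton)
      qed
      then show ?thesis using f by auto
    qed
    show ?thesis
    proof (cases "u \<in> Y")
      case True
      then obtain f where "f \<in> edges ?S'" "splits (verts ?S' - Y) f"
        using *[of "verts ?S' - Y"] Y by auto
      then show ?thesis using splits_Diff[OF edge_subset[OF simple]] by blast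
    qed (use * Y in blast)
  qed
  have cuts: "\<exists>Y. edge_cut ?S' f Y" if f: "f \<in> edges ?S'" for f
  proof -
    obtain Y where Y: "edge_cut S f Y" using tree_edge_cut[OF S] f by auto
    have "splits (Y \<inter> X) g \<longleftrightarrow> g = f" if "g \<in> edges ?S'" for g
      using cut_splits[OF Y, of g] that by (auto simp: splits_def)
    then have "edge_cut ?S' f (Y \<inter> X)" using Y f by (auto simp: edge_cut_def)
    then show ?thesis ..
  qed
  show ?thesis unfolding tree_iff_cuts using simple conn cuts ne by simp
qed

lemma cut_subtree:
  assumes "subtree S G" "edge_cut G e X" "e \<in> edges S"
  shows "edge_cut S e (X \<inter> verts S)"
proof -
  have "simple_graph S" using assms by (auto simp: subtree_def tree_simple)
  then have "splits (X \<inter> verts S) f \<longleftrightarrow> splits X f" if "f \<in> edges S" for f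
    using edge_subset[of S f] that by (auto simp: splits_def)
  moreover have "splits X f \<longleftrightarrow> f = e" if "f \<in> edges S" for f
    using cut_splits[OF assms(2)] assms(1) that by (auto simp: subtree_def)
  ultimately show ?thesis using assms(3) by (auto simp: edge_cut_def)
qed

text \<open>An optimal subtree \<open>S\<close> for \<open>A\<close> has exactly the edges that separate \<open>A\<close>. It needs each of them, since
it is connected and only \<open>e\<close> joins the two sides of \<open>e\<close>. It has no others: if all of \<open>A\<close> lies on one
side of an edge of \<open>S\<close>, the part of \<open>S\<close> on that side is a smaller subtree that contains \<open>A\<close>.\<close>

lemma steiner_dist_eq_cuts:
  assumes G: "tree G" and A: "A \<subseteq> verts G" "A \<noteq> {}"
    and side: "\<And>e. e \<in> edges G \<Longrightarrow> edge_cut G e (side e)"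
  shows "steiner_dist G A = card {e \<in> edges G. splits (side e) A}" (is "_ = card ?F")
proof -
  define P where "P m \<longleftrightarrow> (\<exists>S. subtree S G \<and> A \<subseteq> verts S \<and> card (edges S) = m)" for m
  have "P (card (edges G))" unfolding P_def subtree_def using G A by blast
  then have "P (steiner_dist G A)"
    unfolding steiner_dist_def P_def[symmetric] by (rule LeastI)
  then obtain S where S: "subtree S G" "A \<subseteq> verts S" "card (edges S) = steiner_dist G A"
    by (auto simp: P_def)
  have least: "steiner_dist G A \<le> card (edges R)" if "subtree R G" "A \<subseteq> verts R" for R
    unfolding steiner_dist_def P_def[symmetric] by (rule Least_le) (use that P_def in blast)
  have tS: "tree S" and EV: "edges S \<subseteq> edges G" "verts S \<subseteq> verts G"
    using S(1) by (auto simp: subtree_def)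
  have sS: "simple_graph S" using tS by (rule tree_simple)
  have "edges S = ?F"
  proof
    show "?F \<subseteq> edges S"
    proof
      fix e assume e: "e \<in> ?F"
      then have "edge_cut G e (side e)" using side by blast
      moreover have "side e \<inter> verts S \<noteq> {}" "side e \<inter> verts S \<noteq> verts S"
        using e S(2) by (auto simp: splits_def)
      then obtain f where f: "f \<in> edges S" "splits (side e \<inter> verts S) f"
        using tree_splits[OF tS, of "side e \<inter> verts S"] by blast
      then have "splits (side e) f" using edge_subset[OF sS f(1)] by (auto simp: splits_def)
      ultimately show "e \<in> edges S" using f EV cut_splits by blast
    qed
    show "edges S \<subseteq> ?F"
    proof
      fix e assume e: "e \<in> edges S"
      show "e \<in> ?F"
      proof (rule ccontr)
        assume "e \<notin> ?F"
        then have "\<not> splits (side e) A" using e EV by blast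
        \<comment> \<open>The side of \<open>e\<close> on which \<open>A\<close> lies.\<close>
        define X where "X = (if A \<subseteq> side e then side e else verts G - side e)"
        have "A \<subseteq> X" using \<open>\<not> splits (side e) A\<close> A by (auto simp: X_def splits_def)
        have "edge_cut G e X" using side e EV cut_Diff[OF tree_simple[OF G]] by (auto simp: X_def)
        then have cut: "edge_cut S e (X \<inter> verts S)" using cut_subtree S(1) e by blast
        define R where "R = (verts S \<inter> (X \<inter> verts S), {f \<in> edges S. f \<subseteq> X \<inter> verts S})"
        have "tree R" unfolding R_def
          by (rule subtree_one_side[OF tS cut e]) (use A \<open>A \<subseteq> X\<close> S(2) in blast)
        then have "subtree R G" "A \<subseteq> verts R" using EV \<open>A \<subseteq> X\<close> S(2)
          by (auto simp: subtree_def R_def)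
        then have "card (edges S) \<le> card (edges R)" using least S(3) by simp
        moreover have "e \<notin> edges R"
          using cut_splits[OF cut e] by (auto simp: R_def splits_def)
        then have "edges R \<subset> edges S" using e by (auto simp: R_def)
        then have "card (edges R) < card (edges S)"
          using finite_edges[OF sS] psubset_card_mono by blast
        ultimately show False by simp
      qed
    qed
  qed
  then show ?thesis using S(3) by simp
qed


section \<open>Binomial coefficients and the contribution of an edge\<close>

text \<open>Convexity of \<open>a \<mapsto> (a choose k)\<close>: the increment over a step of length \<open>t\<close> grows with the starting point,
because by Pascal's rule each unit increment is a binomial coefficient for \<open>k - 1\<close>.\<close>

lemma binomial_gap_mono:
  fixes a b k t :: nat
  assumes "a \<le> b"
  shows "((a + t) choose k) + (b choose k) \<le> (a choose k) + ((b + t) choose k)"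
proof (induction t)
  case (Suc t)
  show ?case
  proof (cases k)
    case (Suc j)
    have "(a + t) choose j \<le> (b + t) choose j"
      using assms by (intro binomial_right_mono) simp
    then show ?thesis using Suc Suc.IH by simp
  qed simp
qed simp

lemma binomial_right_strict_mono:
  fixes m n k :: nat
  assumes "m < n" "0 < k" "k \<le> n"
  shows "m choose k < n choose k"
proof -
  obtain n' j where nj: "n = Suc n'" "k = Suc j" using assms by (cases n; cases k) auto
  have "m choose k \<le> n' choose k" using assms nj by (intro binomial_right_mono) simp
  moreover have "0 < n' choose j" using assms nj by (intro zero_less_binomial) simp
  ultimately show ?thesis using nj by (simp del: binomial_eq_0_iff zero_less_binomial_iff)
qed

text \<open>The last unit step already gives a strict gain, from \<open>a + t - 1\<close> and \<open>b + t - 1\<close> over \<open>k - 1\<close>: the second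
coefficient is positive because \<open>k \<le> b + t\<close>.\<close>

lemma binomial_gap_strict_mono:
  fixes a b k t :: nat
  assumes "a < b" "0 < t" "2 \<le> k" "k \<le> b + t"
  shows "((a + t) choose k) + (b choose k) < (a choose k) + ((b + t) choose k)"
proof -
  obtain s j where sj: "t = Suc s" "k = Suc j" using assms by (cases t; cases k) auto
  have "(a + s) choose j < (b + s) choose j"
    using assms sj by (intro binomial_right_strict_mono) auto
  moreover have "((a + s) choose k) + (b choose k) \<le> (a choose k) + ((b + s) choose k)"
    using assms by (intro binomial_gap_mono) simp
  ultimately show ?thesis using sj by simp
qed

text \<open>The number of \<open>k\<close>-subsets of an \<open>n\<close>-set that meet both a fixed \<open>s\<close>-subset and its complement (for
positive \<open>k\<close>). It is the contribution to the Steiner Wiener index of an edge with \<open>s\<close> vertices on one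
side.\<close>

definition cut_count :: "nat \<Rightarrow> nat \<Rightarrow> nat \<Rightarrow> nat" where
  "cut_count n k s = (n choose k) - ((s choose k) + ((n - s) choose k))"

text \<open>The hypotheses say that both parts of the split \<open>s + (n - s)\<close> have at least \<open>m\<close> elements, so that this split
is at least as balanced as \<open>m + (n - m)\<close>; this form does not depend on which part is the
smaller one.\<close>

lemma cut_count_mono:
  assumes "m \<le> s" "m + s \<le> n"
  shows "cut_count n k m \<le> cut_count n k s"
proof -
  have "(s choose k) + ((n - s) choose k) \<le> (m choose k) + ((n - m) choose k)"
    using binomial_gap_mono[of m "n - s" "s - m" k] assms by simp
  then show ?thesis unfolding cut_count_def by (rule diff_le_mono2)
qed

lemma cut_count_strict_mono:
  assumes "m < s" "m + s < n" "2 \<le> k" "k \<le> n - m"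
  shows "cut_count n k m < cut_count n k s"
proof -
  have "(s choose k) + ((n - s) choose k) < (m choose k) + ((n - m) choose k)"
    using binomial_gap_strict_mono[of m "n - s" "s - m" k] assms by simp
  moreover have "(m choose k) + ((n - m) choose k) \<le> n choose k"
    using binomial_gap_mono[of 0 "n - m" m k] assms by (simp add: binomial_eq_0)
  ultimately show ?thesis unfolding cut_count_def by simp
qed

lemma cut_count_eqD:
  assumes "cut_count n k s = cut_count n k m"
    and "m \<le> s" "m + s \<le> n" "2 \<le> k" "k \<le> n - m"
  shows "s = m \<or> s = n - m"
  using cut_count_strict_mono[of m s n k] assms by fastforce

lemma card_split_subsets:
  assumes V: "finite V" and X: "X \<subseteq> V" and k: "0 < k"
  shows "card {A. A \<subseteq> V \<and> card A = k \<and> splits X A} = cut_count (card V) k (card X)"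
proof -
  let ?S = "\<lambda>Y. {A. A \<subseteq> Y \<and> card A = k}"
  have fin: "finite (?S Y)" if "Y \<subseteq> V" for Y
    by (rule finite_subset[of _ "Pow V"]) (use that V in auto)
  have "{A. A \<subseteq> V \<and> card A = k \<and> splits X A} = ?S V - (?S X \<union> ?S (V - X))"
    by (auto simp: splits_def)
  moreover have "card (?S V - (?S X \<union> ?S (V - X))) = card (?S V) - card (?S X \<union> ?S (V - X))"
    by (rule card_Diff_subset) (use fin X in auto)
  moreover have "card (?S X \<union> ?S (V - X)) = card (?S X) + card (?S (V - X))"
  proof (rule card_Un_disjoint)
    have False if "A \<subseteq> X" "A \<subseteq> V - X" "card A = k" for A
    proof -
      have "A = {}" using that by blast
      then show False using that(3) k by simp
    qed
    then show "?S X \<inter> ?S (V - X) = {}" by blast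
  qed (use fin X in auto)
  moreover have "card (V - X) = card V - card X"
    using X finite_subset[OF X V] by (simp add: card_Diff_subset)
  ultimately show ?thesis
    using V finite_subset[OF X V] by (simp add: n_subsets cut_count_def)
qed

text \<open>Double counting of the pairs of a \<open>k\<close>-set and an edge that separates it.\<close>

lemma steiner_wiener_eq_cut_counts:
  assumes G: "tree G" and k: "0 < k"
    and side: "\<And>e. e \<in> edges G \<Longrightarrow> edge_cut G e (side e)"
  shows "steiner_wiener k G = (\<Sum>e \<in> edges G. cut_count (card (verts G)) k (card (side e)))"
proof -
  let ?S = "{A. A \<subseteq> verts G \<and> card A = k}"
  have fV: "finite (verts G)" and fE: "finite (edges G)"
    using tree_simple[OF G] finite_edges[of G] by (auto simp: simple_graph_def)
  have fS: "finite ?S" by (rule finite_subset[of _ "Pow (verts G)"]) (use fV in auto)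
  have "steiner_wiener k G = (\<Sum>A \<in> ?S. card {e \<in> edges G. splits (side e) A})"
    unfolding steiner_wiener_def
  proof (rule sum.cong)
    fix A assume "A \<in> ?S"
    then show "steiner_dist G A = card {e \<in> edges G. splits (side e) A}"
      using k by (intro steiner_dist_eq_cuts G side) auto
  qed simp
  also have "\<dots> = (\<Sum>A \<in> ?S. \<Sum>e \<in> edges G. if splits (side e) A then 1 else 0)"
    using fE by (simp add: sum.If_cases Int_def)
  also have "\<dots> = (\<Sum>e \<in> edges G. \<Sum>A \<in> ?S. if splits (side e) A then 1 else 0)"
    by (rule sum.swap)
  also have "\<dots> = (\<Sum>e \<in> edges G. card {A. A \<subseteq> verts G \<and> card A = k \<and> splits (side e) A})"
    using fS by (simp add: sum.If_cases Int_def conj_assoc)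
  also have "\<dots> = (\<Sum>e \<in> edges G. cut_count (card (verts G)) k (card (side e)))"
    using side k fV by (intro sum.cong refl card_split_subsets) (auto simp: edge_cut_def)
  finally show ?thesis .
qed

section \<open>Paths in a tree\<close>

definition path_edge :: "(nat \<Rightarrow> 'a) \<Rightarrow> nat \<Rightarrow> 'a set" where
  "path_edge p i = {p i, p (Suc i)}"

definition is_path :: "'a graph \<Rightarrow> nat \<Rightarrow> (nat \<Rightarrow> 'a) \<Rightarrow> bool" where
  "is_path G d p \<longleftrightarrow> inj_on p {..d} \<and> p ` {..d} \<subseteq> verts G \<and> path_edge p ` {..<d} \<subseteq> edges G"

lemma inj_on_path_edge:
  assumes "inj_on p {..d}"
  shows "inj_on (path_edge p) {..<d}"
proof (rule inj_onI)
  fix i j assume ij: "i \<in> {..<d}" "j \<in> {..<d}" "path_edge p i = path_edge p j"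
  have p: "p a = p b \<longleftrightarrow> a = b" if "a \<le> d" "b \<le> d" for a b
    using assms that by (auto simp: inj_on_eq_iff)
  show "i = j" using ij by (auto simp: path_edge_def doubleton_eq_iff p)
qed

text \<open>A shortest walk between two vertices at distance \<open>d\<close>.\<close>

lemma diameter_path:
  assumes G: "tree G" and d: "graph_diameter G = d"
  shows "\<exists>p. is_path G d p"
proof -
  have V: "finite (verts G)" "verts G \<noteq> {}"
    using G by (auto simp: tree_iff_cuts simple_graph_def)
  obtain u where u: "u \<in> verts G" "eccentricity G u = d"
    using Max_in[of "eccentricity G ` verts G"] V d unfolding graph_diameter_def by fastforce
  obtain v where v: "v \<in> verts G" "graph_dist G u v = d"
    using Max_in[of "graph_dist G u ` verts G"] V u(2) unfolding eccentricity_def by fastforce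
  obtain zs where zs: "walk G zs" "hd zs = u" "last zs = v"
    using G u(1) v(1) unfolding tree_def connected_graph_def by meson
  obtain xs where xs: "walk G xs" "hd xs = u" "last xs = v" "distinct xs"
    "\<And>ys. walk G ys \<Longrightarrow> hd ys = u \<Longrightarrow> last ys = v \<Longrightarrow> length xs \<le> length ys"
    using obtain_shortest_walk[OF zs(1)] zs by metis
  have ne: "xs \<noteq> []" using xs(1) by (simp add: walk_def)
  have "graph_dist G u v = length xs - 1"
    unfolding graph_dist_def
  proof (rule Least_equality)
    show "\<exists>ys. walk G ys \<and> hd ys = u \<and> last ys = v \<and> length ys = length xs - 1 + 1"
      using xs(1-3) ne by (intro exI[of _ xs]) (cases xs; auto)
  qed (use xs(5) in fastforce)
  then have len: "length xs = Suc d" using v(2) ne by (cases xs) auto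
  have "is_path G d (\<lambda>i. xs ! i)"
    unfolding is_path_def path_edge_def
  proof (intro conjI)
    show "inj_on ((!) xs) {..d}" using xs(4) len by (auto simp: inj_on_nth)
    show "(!) xs ` {..d} \<subseteq> verts G" using xs(1) len by (force simp: walk_def)
    show "(\<lambda>i. {xs ! i, xs ! Suc i}) ` {..<d} \<subseteq> edges G" using walk_edge[OF xs(1)] len by auto
  qed
  then show ?thesis by blast
qed

lemma path_same_side:
  assumes p: "is_path G d p" and X: "edge_cut G e X" and "i \<le> j" "j \<le> d"
    and "\<And>l. i \<le> l \<Longrightarrow> l < j \<Longrightarrow> path_edge p l \<noteq> e"
  shows "p i \<in> X \<longleftrightarrow> p j \<in> X"
  using assms(3-)
proof (induction j rule: dec_induct)
  case (step l)
  have "path_edge p l \<in> edges G" using p step by (auto simp: is_path_def)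
  then have "\<not> splits X (path_edge p l)" using X step by (simp add: cut_splits)
  then show ?case using step by (auto simp: path_edge_def splits_doubleton)
qed simp

lemma path_edge_sides:
  assumes p: "is_path G d p" and X: "edge_cut G (path_edge p i) X" and i: "i < d" and "p 0 \<in> X"
  shows "p ` {..i} \<subseteq> X" "p ` {Suc i..d} \<subseteq> verts G - X"
proof -
  have inj: "path_edge p l \<noteq> path_edge p i" if "l < d" "l \<noteq> i" for l
    using inj_on_path_edge[of p d] p that i by (auto simp: is_path_def inj_on_eq_iff)
  have low: "p j \<in> X" if "j \<le> i" for j
    using path_same_side[OF p X, of 0 j] inj that i \<open>p 0 \<in> X\<close> by auto
  then show "p ` {..i} \<subseteq> X" by auto
  have "path_edge p i \<in> edges G" using p i by (auto simp: is_path_def)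
  then have "splits X (path_edge p i)" using X by (simp add: cut_splits)
  then have "p (Suc i) \<notin> X" using low[of i] by (auto simp: path_edge_def splits_doubleton)
  moreover have "p (Suc i) \<in> X \<longleftrightarrow> p j \<in> X" if "Suc i \<le> j" "j \<le> d" for j
    using path_same_side[OF p X, of "Suc i" j] inj that by auto
  ultimately show "p ` {Suc i..d} \<subseteq> verts G - X" using p by (auto simp: is_path_def)
qed

lemma card_path_edge_sides:
  assumes G: "simple_graph G" and p: "is_path G d p" and X: "edge_cut G (path_edge p i) X"
    and i: "i < d" and "p 0 \<in> X"
  shows "Suc i \<le> card X" "card X + (d - i) \<le> card (verts G)"
proof -
  note s = path_edge_sides[OF p X i \<open>p 0 \<in> X\<close>]
  have fin: "finite (verts G)" "X \<subseteq> verts G" using G X by (auto simp: simple_graph_def edge_cut_def)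
  then have fX: "finite X" using finite_subset by blast
  have inj: "inj_on p {..i}" "inj_on p {Suc i..d}"
    using p i by (auto simp: is_path_def intro!: inj_on_subset[of p "{..d}"])
  show "Suc i \<le> card X" using card_mono[OF fX s(1)] card_image[OF inj(1)] by simp
  have "d - i \<le> card (verts G - X)"
    using card_mono[OF _ s(2)] card_image[OF inj(2)] fin by simp
  moreover have "card X + card (verts G - X) = card (verts G)"
    using fin fX by (simp add: card_Diff_subset card_mono)
  ultimately show "card X + (d - i) \<le> card (verts G)" by simp
qed

text \<open>Starting from \<open>P\<close>, every new vertex can be attached by a new edge until all vertices are
reached.\<close>

lemma card_edges_leaving:
  assumes G: "tree G" and P: "P \<subseteq> verts G" "P \<noteq> {}"
  shows "card (verts G - P) \<le> card {e \<in> edges G. \<not> e \<subseteq> P}"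
proof -
  have fV: "finite (verts G)" and sG: "simple_graph G"
    using tree_simple[OF G] by (auto simp: simple_graph_def)
  note fE = finite_edges[OF sG]
  have "\<exists>Y. P \<subseteq> Y \<and> Y \<subseteq> verts G \<and> card (Y - P) = m \<and>
      m \<le> card {e \<in> edges G. e \<subseteq> Y \<and> \<not> e \<subseteq> P}" if "m \<le> card (verts G - P)" for m
    using that
  proof (induction m)
    case 0
    show ?case using P by (intro exI[of _ P]) auto
  next
    case (Suc m)
    then obtain Y where Y: "P \<subseteq> Y" "Y \<subseteq> verts G" "card (Y - P) = m"
      "m \<le> card {e \<in> edges G. e \<subseteq> Y \<and> \<not> e \<subseteq> P}" by auto
    then have "Y \<noteq> verts G" "Y \<noteq> {}" using Suc.prems P by auto
    then obtain e where e: "e \<in> edges G" "splits Y e" using tree_splits[OF G Y(2)] by blast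
    obtain a b where ab: "e = {a, b}" "a \<in> Y" "b \<notin> Y"
      using edge_doubleton[OF sG e(1)] e(2) by (metis splits_doubleton insert_commute)
    have b: "b \<in> verts G" using edge_subset[OF sG e(1)] ab by auto
    have "finite (Y - P)" using Y(2) fV finite_subset by blast
    moreover have "insert b Y - P = insert b (Y - P)" using ab Y by auto
    ultimately have "card (insert b Y - P) = Suc m" using ab Y(3) by simp
    moreover have "Suc m \<le> card {e \<in> edges G. e \<subseteq> insert b Y \<and> \<not> e \<subseteq> P}"
    proof -
      have "insert e {e \<in> edges G. e \<subseteq> Y \<and> \<not> e \<subseteq> P} \<subseteq> {e \<in> edges G. e \<subseteq> insert b Y \<and> \<not> e \<subseteq> P}"
        using e ab Y by auto
      then have "card (insert e {e \<in> edges G. e \<subseteq> Y \<and> \<not> e \<subseteq> P})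
          \<le> card {e \<in> edges G. e \<subseteq> insert b Y \<and> \<not> e \<subseteq> P}"
        using fE by (intro card_mono) auto
      moreover have "e \<notin> {e \<in> edges G. e \<subseteq> Y \<and> \<not> e \<subseteq> P}" using ab by auto
      ultimately show ?thesis using Y(4) fE by simp
    qed
    ultimately show ?case using Y b by (intro exI[of _ "insert b Y"]) auto
  qed
  from this[of "card (verts G - P)"] obtain Y where
    "card (verts G - P) \<le> card {e \<in> edges G. e \<subseteq> Y \<and> \<not> e \<subseteq> P}" by auto
  also have "\<dots> \<le> card {e \<in> edges G. \<not> e \<subseteq> P}" using fE by (intro card_mono) auto
  finally show ?thesis .
qed


section \<open>The lower bound\<close>

text \<open>The contributions of the \<open>d\<close> edges of a path of which each has as few vertices as possible on its smaller
side, and of \<open>n - d - 1\<close> pendent edges. This is the common lower bound, attained by \<open>T_graph\<close>.\<close>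

definition extremal_value :: "nat \<Rightarrow> nat \<Rightarrow> nat \<Rightarrow> nat" where
  "extremal_value k d n =
     (\<Sum>i<d. cut_count n k (min (Suc i) (d - i))) + (n - Suc d) * cut_count n k 1"

lemma sum_path_edges:
  assumes "simple_graph G" "is_path G d p"
  shows "(\<Sum>e \<in> edges G. f e) =
    (\<Sum>i<d. f (path_edge p i)) + (\<Sum>e \<in> edges G - path_edge p ` {..<d}. f e)"
proof -
  have "path_edge p ` {..<d} \<subseteq> edges G" using assms by (simp add: is_path_def)
  then have "(\<Sum>e \<in> edges G. f e) =
      (\<Sum>e \<in> edges G - path_edge p ` {..<d}. f e) + (\<Sum>e \<in> path_edge p ` {..<d}. f e)"
    using finite_edges[OF assms(1)] by (rule sum.subset_diff)
  then show ?thesis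
    using inj_on_path_edge[of p d] assms(2) by (simp add: sum.reindex is_path_def add.commute)
qed

lemma card_other_edges:
  assumes G: "tree G" and p: "is_path G d p"
  shows "card (verts G) - Suc d \<le> card (edges G - path_edge p ` {..<d})"
proof -
  have V: "finite (verts G)" and sG: "simple_graph G"
    using tree_simple[OF G] by (auto simp: simple_graph_def)
  have "card (verts G) - Suc d = card (verts G - p ` {..d})"
    using V p card_image[of p "{..d}"] by (simp add: is_path_def card_Diff_subset)
  also have "\<dots> \<le> card {e \<in> edges G. \<not> e \<subseteq> p ` {..d}}"
    using card_edges_leaving[OF G, of "p ` {..d}"] p by (simp add: is_path_def)
  also have "\<dots> \<le> card (edges G - path_edge p ` {..<d})"
    using finite_edges[OF sG] by (intro card_mono) (auto simp: path_edge_def)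
  finally show ?thesis .
qed

lemma card_cut_bounds:
  assumes "simple_graph G" "edge_cut G e X"
  shows "1 \<le> card X" "card X + 1 \<le> card (verts G)"
proof -
  have X: "X \<subseteq> verts G" "splits X e" "e \<subseteq> verts G" "finite (verts G)"
    using assms by (auto simp: edge_cut_def simple_graph_def)
  then have "X \<noteq> {}" "X \<subset> verts G" by (auto simp: splits_def)
  then show "1 \<le> card X" "card X + 1 \<le> card (verts G)"
    using X psubset_card_mono[of "verts G" X] finite_subset[of X "verts G"]
    by (auto simp: Suc_le_eq card_gt_0_iff)
qed

text \<open>The \<open>i\<close>-th edge of the path has \<open>i + 1\<close> vertices of the path on one side and \<open>d - i\<close> on the other.\<close>

lemma path_edge_cut_count:
  assumes "simple_graph G" "is_path G d p" "edge_cut G (path_edge p i) X" "i < d" "p 0 \<in> X"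
  shows "cut_count (card (verts G)) k (min (Suc i) (d - i)) \<le> cut_count (card (verts G)) k (card X)"
  using card_path_edge_sides[OF assms] by (intro cut_count_mono) auto

text \<open>Equality in \<open>m * c \<le> card B * c \<le> sum f B\<close> forces \<open>f\<close> to be constant on \<open>B\<close>.\<close>

lemma sum_eq_bound:
  fixes f :: "'b \<Rightarrow> nat"
  assumes "finite B" "\<And>x. x \<in> B \<Longrightarrow> c \<le> f x" "m \<le> card B"
  shows "m * c \<le> sum f B"
    and "sum f B = m * c \<Longrightarrow> x \<in> B \<Longrightarrow> f x = c"
proof -
  have le: "m * c \<le> (\<Sum>x\<in>B. c)" "(\<Sum>x\<in>B. c) \<le> sum f B"
    using assms by (simp, intro sum_mono)
  then show "m * c \<le> sum f B" by linarith
  assume "sum f B = m * c" "x \<in> B"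
  then have "(\<Sum>x\<in>B. c) = sum f B" using le by linarith
  then have "c = f x"
    using sum_mono_inv[of "\<lambda>_. c" B f x] \<open>x \<in> B\<close> assms(1,2) by auto
  then show "f x = c" by simp
qed

text \<open>Every edge of the path and every other edge contributes at least as much as its counterpart in
\<open>extremal_value\<close>, and there are at least \<open>n - d - 1\<close> other edges. Hence equality of the sums means
equality edge by edge. The root \<open>p 0\<close> only fixes which of the two sides \<open>side e\<close> stands for.\<close>

lemma steiner_wiener_lower_bound:
  assumes G: "tree G" and p: "is_path G d p" and k: "0 < k"
    and side: "\<And>e. e \<in> edges G \<Longrightarrow> edge_cut G e (side e) \<and> p 0 \<in> side e"
    and n: "card (verts G) = n"
  shows "extremal_value k d n \<le> steiner_wiener k G"
    and "steiner_wiener k G = extremal_value k d n \<Longrightarrow> i < d \<Longrightarrow>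
      cut_count n k (card (side (path_edge p i))) = cut_count n k (min (Suc i) (d - i))"
    and "steiner_wiener k G = extremal_value k d n \<Longrightarrow> e \<in> edges G - path_edge p ` {..<d} \<Longrightarrow>
      cut_count n k (card (side e)) = cut_count n k 1"
proof -
  have sG: "simple_graph G" using G by (rule tree_simple)
  define f where "f e = cut_count n k (card (side e))" for e
  let ?O = "edges G - path_edge p ` {..<d}"
  have SW: "steiner_wiener k G = (\<Sum>i<d. f (path_edge p i)) + sum f ?O"
    using steiner_wiener_eq_cut_counts[OF G k, of side] side n sum_path_edges[OF sG p, of f]
    by (simp add: f_def)
  have P: "cut_count n k (min (Suc i) (d - i)) \<le> f (path_edge p i)" if "i \<in> {..<d}" for i
    using path_edge_cut_count[OF sG p, of i "side (path_edge p i)"] side p that n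
    by (auto simp: f_def is_path_def)
  have sumP: "(\<Sum>i<d. cut_count n k (min (Suc i) (d - i))) \<le> (\<Sum>i<d. f (path_edge p i))"
    by (rule sum_mono) (rule P)
  have O: "cut_count n k 1 \<le> f e" if "e \<in> ?O" for e
    unfolding f_def using card_cut_bounds[OF sG, of e "side e"] side[of e] that n
    by (intro cut_count_mono) auto
  have finO: "finite ?O" using finite_edges[OF sG] by simp
  have cO: "n - Suc d \<le> card ?O" using card_other_edges[OF G p] n by simp
  have sumO: "(n - Suc d) * cut_count n k 1 \<le> sum f ?O"
    by (rule sum_eq_bound(1)[OF finO O cO])
  show "extremal_value k d n \<le> steiner_wiener k G"
    using SW sumP sumO by (simp add: extremal_value_def)
  assume eq: "steiner_wiener k G = extremal_value k d n"
  then have eqP: "(\<Sum>i<d. cut_count n k (min (Suc i) (d - i))) = (\<Sum>i<d. f (path_edge p i))"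
    and eqO: "sum f ?O = (n - Suc d) * cut_count n k 1"
    using SW sumP sumO by (simp_all add: extremal_value_def)
  show "cut_count n k (card (side (path_edge p i))) = cut_count n k (min (Suc i) (d - i))"
    if "i < d"
    using sum_mono_inv[OF eqP P, of i] that by (simp add: f_def)
  show "cut_count n k (card (side e)) = cut_count n k 1" if "e \<in> ?O"
    using sum_eq_bound(2)[OF finO O cO eqO that] by (simp add: f_def)
qed

section \<open>The index of the extremal tree\<close>

lemma T_graph_verts: "d < n \<Longrightarrow> verts (T_graph d n c) = {..<n}"
  by (auto simp: T_graph_def path_graph_def)

lemma T_graph_edges:
  "edges (T_graph d n c) = path_edge (\<lambda>i. i) ` {..<d} \<union> (\<lambda>j. {c, j}) ` {d<..<n}"
  by (auto simp: T_graph_def path_graph_def path_edge_def)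

text \<open>The path edge \<open>{i, i + 1}\<close> gets the side that does not contain the vertex \<open>c\<close>, which is the smaller one
for a central \<open>c\<close>; a pendent edge gets its leaf. As \<open>c \<le> d\<close>, the maximum of an edge tells whether it is
pendent.\<close>

definition T_side :: "nat \<Rightarrow> nat \<Rightarrow> nat set \<Rightarrow> nat set" where
  "T_side d c e =
     (if Max e \<le> d then (if Min e < c then {..Min e} else {Suc (Min e)..d}) else {Max e})"

lemma T_side_path_edge:
  "i < d \<Longrightarrow> T_side d c (path_edge (\<lambda>i. i) i) = (if i < c then {..i} else {Suc i..d})"
  by (simp add: T_side_def path_edge_def)

lemma T_side_pendant: "c \<le> d \<Longrightarrow> d < j \<Longrightarrow> T_side d c {c, j} = {j}"
  by (simp add: T_side_def)

lemma T_graph_edge_cut: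
  assumes c: "c \<le> d" and dn: "d < n" and e: "e \<in> edges (T_graph d n c)"
  shows "edge_cut (T_graph d n c) e (T_side d c e)"
proof -
  let ?T = "T_graph d n c"
  consider (path) i where "i < d" "e = path_edge (\<lambda>i. i) i" | (pendant) j where "d < j" "j < n" "e = {c, j}"
    using e unfolding T_graph_edges by auto
  then show ?thesis
  proof cases
    case path
    have X: "splits (T_side d c e) (path_edge (\<lambda>i. i) l) \<longleftrightarrow> l = i" if "l < d" for l
      using that path by (auto simp: T_side_path_edge, auto simp: path_edge_def splits_doubleton)
    have Y: "\<not> splits (T_side d c e) {c, j}" if "d < j" for j
      using that path c by (auto simp: T_side_path_edge splits_doubleton)
    have "T_side d c e \<subseteq> verts ?T"
      using path c dn by (auto simp: T_side_path_edge T_graph_verts)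
    then show ?thesis
      using X Y path unfolding edge_cut_def T_graph_edges by auto
  next
    case pendant
    have S: "T_side d c e = {j}" using pendant c by (simp add: T_side_pendant)
    have X: "\<not> splits {j} (path_edge (\<lambda>i. i) l)" if "l < d" for l
      using that pendant by (auto simp: path_edge_def splits_doubleton)
    have Y: "splits {j} {c, l} \<longleftrightarrow> l = j" if "d < l" for l
      using that pendant c by (auto simp: splits_doubleton)
    show ?thesis
      using X Y pendant dn unfolding edge_cut_def T_graph_edges S by (auto simp: T_graph_verts)
  qed
qed

lemma T_graph_tree:
  assumes c: "c \<le> d" and dn: "d < n"
  shows "tree (T_graph d n c)"
proof -
  let ?T = "T_graph d n c"
  have simple: "simple_graph ?T"
    using c dn unfolding simple_graph_def T_graph_edges
    by (auto simp: T_graph_verts path_edge_def)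
  have "\<exists>e \<in> edges ?T. splits X e" if X: "X \<subseteq> verts ?T" "X \<noteq> {}" "X \<noteq> verts ?T" for X
  proof (rule ccontr)
    assume no: "\<not> (\<exists>e \<in> edges ?T. splits X e)"
    have path: "i \<in> X \<longleftrightarrow> 0 \<in> X" if "i \<le> d" for i
      using that
    proof (induction i)
      case (Suc i)
      then have "\<not> splits X (path_edge (\<lambda>i. i) i)" using no unfolding T_graph_edges by auto
      then show ?case using Suc by (auto simp: path_edge_def splits_doubleton)
    qed simp
    have "j \<in> X \<longleftrightarrow> 0 \<in> X" if "j < n" for j
    proof (cases "j \<le> d")
      case False
      then have "\<not> splits X {c, j}" using no that unfolding T_graph_edges by auto
      then show ?thesis using path[OF c] by (auto simp: splits_doubleton)
    qed (rule path)
    then show False using X dn by (auto simp: T_graph_verts)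
  qed
  then show ?thesis
    unfolding tree_iff_cuts using simple T_graph_edge_cut[OF c dn] dn T_graph_verts by auto
qed

text \<open>All pendent vertices hang at the middle of the path, so every edge has the smallest possible
side.\<close>

lemma steiner_wiener_T_graph:
  assumes c: "d \<le> 2 * c + 1" "2 * c \<le> d + 1" "c \<le> d" and dn: "d < n" and k: "0 < k"
  shows "steiner_wiener k (T_graph d n c) = extremal_value k d n"
proof -
  let ?T = "T_graph d n c" and ?p = "path_edge (\<lambda>i::nat. i)"
  define f where "f e = cut_count n k (card (T_side d c e))" for e
  have sw: "steiner_wiener k ?T = (\<Sum>e \<in> edges ?T. f e)"
    using steiner_wiener_eq_cut_counts[OF T_graph_tree k T_graph_edge_cut] c dn
    by (simp add: f_def T_graph_verts)
  have disj: "?p ` {..<d} \<inter> (\<lambda>j. {c, j}) ` {d<..<n} = {}"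
    by (auto simp: path_edge_def doubleton_eq_iff)
  have inj: "inj_on ?p {..<d}" "inj_on (\<lambda>j. {c, j}) {d<..<n}"
    by (auto intro: inj_on_path_edge) (auto simp: inj_on_def doubleton_eq_iff)
  have "(\<Sum>e \<in> edges ?T. f e) = (\<Sum>i<d. f (?p i)) + (\<Sum>j\<in>{d<..<n}. f {c, j})"
    unfolding T_graph_edges using disj inj by (simp add: sum.union_disjoint sum.reindex)
  moreover have "f (?p i) = cut_count n k (min (Suc i) (d - i))" if "i \<in> {..<d}" for i
    using that c by (auto simp: f_def T_side_path_edge min_def intro!: arg_cong[of _ _ "cut_count n k"])
  moreover have "f {c, j} = cut_count n k 1" if "j \<in> {d<..<n}" for j
    using that c by (simp add: f_def T_side_pendant)
  ultimately show ?thesis by (simp add: sw extremal_value_def)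
qed

section \<open>Recognizing the extremal tree\<close>

text \<open>The shape of \<open>T_graph\<close> inside an arbitrary vertex type, with the pendent edges attached at \<open>p b\<close>.\<close>

definition pendants_at :: "'a graph \<Rightarrow> nat \<Rightarrow> (nat \<Rightarrow> 'a) \<Rightarrow> nat \<Rightarrow> bool" where
  "pendants_at G d p b \<longleftrightarrow> is_path G d p \<and> b \<le> d \<and>
     edges G = path_edge p ` {..<d} \<union> (\<lambda>x. {p b, x}) ` (verts G - p ` {..d})"

lemma isomorphicI:
  assumes f: "bij_betw f (verts G) (verts H)" and E: "edges H = (`) f ` edges G"
    and G: "simple_graph G"
  shows "isomorphic G H"
proof -
  have "{u, v} \<in> edges G \<longleftrightarrow> {f u, f v} \<in> edges H" if uv: "u \<in> verts G" "v \<in> verts G" for u v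
  proof -
    have "inj_on ((`) f) (Pow (verts G))"
      using f by (auto simp: bij_betw_def intro: inj_on_image_Pow)
    moreover have "edges G \<subseteq> Pow (verts G)" using edge_subset[OF G] by auto
    ultimately have "f ` {u, v} \<in> (`) f ` edges G \<longleftrightarrow> {u, v} \<in> edges G"
      using uv by (intro inj_on_image_mem_iff) auto
    then show ?thesis using E by simp
  qed
  then show ?thesis using f by (auto simp: isomorphic_def)
qed

lemma pendants_at_isomorphic:
  assumes G: "simple_graph G" and p: "pendants_at G d p b" and n: "card (verts G) = n" and dn: "d < n"
  shows "isomorphic G (T_graph d n b)"
proof -
  define W where "W = verts G - p ` {..d}"
  have path: "inj_on p {..d}" "p ` {..d} \<subseteq> verts G" and b: "b \<le> d"
    and E: "edges G = path_edge p ` {..<d} \<union> (\<lambda>x. {p b, x}) ` W"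
    using p by (auto simp: pendants_at_def is_path_def W_def)
  have V: "finite (verts G)" using G by (simp add: simple_graph_def)
  have "card W = n - Suc d"
    using V path n card_image[OF path(1)] by (simp add: W_def card_Diff_subset)
  then obtain g where g: "bij_betw g W {d<..<n}"
    using V finite_same_card_bij[of W "{d<..<n}"] by (auto simp: W_def)
  define f where "f x = (if x \<in> W then g x else inv_into {..d} p x)" for x
  have fp: "f (p i) = i" if "i \<le> d" for i
    using path that by (auto simp: f_def W_def)
  have "bij_betw f W {d<..<n}" using g bij_betw_cong[of W f g] by (simp add: f_def)
  moreover have "bij_betw f (p ` {..d}) {..d}"
    using fp by (intro bij_betw_byWitness[where f' = p]) auto
  ultimately have "bij_betw f (W \<union> p ` {..d}) ({d<..<n} \<union> {..d})"
    by (rule bij_betw_combine) auto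
  moreover have "W \<union> p ` {..d} = verts G" using path by (auto simp: W_def)
  moreover have "{d<..<n} \<union> {..d} = {..<n}" using dn by auto
  ultimately have bij: "bij_betw f (verts G) (verts (T_graph d n b))"
    using dn by (simp add: T_graph_verts)
  have "(`) f ` path_edge p ` {..<d} = path_edge (\<lambda>i. i) ` {..<d}"
    unfolding image_image path_edge_def by (rule image_cong) (auto simp: fp)
  moreover have "(`) f ` (\<lambda>x. {p b, x}) ` W = (\<lambda>j. {b, j}) ` g ` W"
    unfolding image_image by (rule image_cong) (auto simp: fp b f_def[of "_::'a"] W_def path)
  ultimately have "edges (T_graph d n b) = (`) f ` edges G"
    using g unfolding E T_graph_edges image_Un bij_betw_def by simp
  then show ?thesis using isomorphicI[OF bij _ G] by simp
qed

text \<open>For odd \<open>d\<close> the path has two central vertices; reversing the path exchanges them.\<close>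

lemma pendants_at_reverse:
  assumes "pendants_at G d p b"
  shows "pendants_at G d (\<lambda>i. p (d - i)) (d - b)"
proof -
  have rev: "(\<lambda>i. d - i) ` {..d} = {..d}" "(\<lambda>i. d - Suc i) ` {..<d} = {..<d}"
  proof -
    have "i \<in> (\<lambda>i. d - i) ` {..d}" if "i \<le> d" for i
      using that by (intro image_eqI[of _ _ "d - i"]) auto
    then show "(\<lambda>i. d - i) ` {..d} = {..d}" by auto
    have "i \<in> (\<lambda>i. d - Suc i) ` {..<d}" if "i < d" for i
      using that by (intro image_eqI[of _ _ "d - Suc i"]) auto
    then show "(\<lambda>i. d - Suc i) ` {..<d} = {..<d}" by auto
  qed
  have im: "(\<lambda>i. p (d - i)) ` {..d} = p ` {..d}"
    using rev(1) by (metis image_image)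
  have "path_edge (\<lambda>i. p (d - i)) i = path_edge p (d - Suc i)" if "i < d" for i
    using that by (auto simp: path_edge_def Suc_diff_Suc)
  then have "path_edge (\<lambda>i. p (d - i)) ` {..<d} = (\<lambda>i. path_edge p (d - Suc i)) ` {..<d}"
    by (intro image_cong) auto
  then have pe: "path_edge (\<lambda>i. p (d - i)) ` {..<d} = path_edge p ` {..<d}"
    using rev(2) by (metis image_image)
  have "inj_on (\<lambda>i. p (d - i)) {..d}"
    using assms unfolding pendants_at_def is_path_def
    by (intro comp_inj_on[of "\<lambda>i. d - i" _ p, unfolded comp_def]) (auto simp: rev inj_on_def)
  then show ?thesis using assms by (simp add: pendants_at_def is_path_def im pe)
qed


section \<open>The case of equality\<close>

text \<open>By \<open>low\<close> and \<open>high\<close>, nothing branches off before \<open>p b\<close> or after it, so an edge that leaves the path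
leaves it at \<open>p b\<close>. By \<open>leaf\<close>, every edge outside the path ends in a leaf. Outside vertices that
are not adjacent to \<open>p b\<close> could be linked to the rest only by an outside vertex \<open>y\<close> adjacent to \<open>p b\<close>; but the
leaf of the edge from \<open>y\<close> to \<open>p b\<close> can only be \<open>y\<close>, which then has no other edge.\<close>

lemma pendants_atI:
  assumes G: "tree G" and p: "is_path G d p" and b: "b \<le> d"
    and low: "\<And>i. i < b \<Longrightarrow> edge_cut G (path_edge p i) (p ` {..i})"
    and high: "\<And>i. b \<le> i \<Longrightarrow> i < d \<Longrightarrow> edge_cut G (path_edge p i) (p ` {Suc i..d})"
    and leaf: "\<And>e. e \<in> edges G - path_edge p ` {..<d} \<Longrightarrow>
      \<exists>x \<in> verts G - p ` {..d}. edge_cut G e {x}"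
  shows "pendants_at G d p b"
proof -
  let ?P = "p ` {..d}" and ?F = "path_edge p ` {..<d}"
  have sG: "simple_graph G" using G by (rule tree_simple)
  have P: "inj_on p {..d}" "?P \<subseteq> verts G" "?F \<subseteq> edges G" using p by (auto simp: is_path_def)
  have pp: "p i = p j \<longleftrightarrow> i = j" if "i \<le> d" "j \<le> d" for i j
    using P(1) that by (auto simp: inj_on_eq_iff)
  have at_b: "y = p b" if e: "{x, y} \<in> edges G" and x: "x \<notin> ?P" and y: "y \<in> ?P" for x y
  proof -
    obtain j where j: "j \<le> d" "y = p j" using y by auto
    have not_path: "{x, y} \<noteq> path_edge p i" if "i < d" for i
      using x that by (auto simp: path_edge_def doubleton_eq_iff)
    have "\<not> j < b"
    proof
      assume "j < b"
      then have "splits (p ` {..j}) {x, y} \<longleftrightarrow> {x, y} = path_edge p j"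
        using cut_splits[OF low e] by simp
      moreover have "splits (p ` {..j}) {x, y}" using x j by (auto simp: splits_doubleton)
      ultimately show False using not_path[of j] \<open>j < b\<close> b by simp
    qed
    moreover have "\<not> b < j"
    proof
      assume "b < j"
      then obtain i where i: "j = Suc i" "b \<le> i" "i < d" using j by (cases j) auto
      then have "splits (p ` {Suc i..d}) {x, y} \<longleftrightarrow> {x, y} = path_edge p i"
        using cut_splits[OF high e] by simp
      moreover have "splits (p ` {Suc i..d}) {x, y}" using x j i by (auto simp: splits_doubleton)
      ultimately show False using not_path[of i] i by simp
    qed
    ultimately show ?thesis using j by (metis linorder_neqE_nat)
  qed
  have only: "e' = e" if "edge_cut G e {x}" "e' \<in> edges G" "x \<in> e'" for e e' x
  proof -
    have "splits {x} e'" using edge_doubleton[OF sG that(2)] that(3)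
      by (metis splits_doubleton insertE singletonD singletonI)
    then show ?thesis using cut_splits[OF that(1,2)] by simp
  qed
  define W where "W = {x \<in> verts G - ?P. {x, p b} \<notin> edges G}"
  \<comment> \<open>\<open>W\<close> collects the outside vertices that are not joined to \<open>p b\<close>.\<close>
  have "W = {}"
  proof (rule ccontr)
    assume "W \<noteq> {}"
    moreover have "W \<noteq> verts G" "W \<subseteq> verts G" using P(2) b by (auto simp: W_def)
    ultimately obtain e where e: "e \<in> edges G" "splits W e" using tree_splits[OF G, of W] by auto
    obtain x y where xy: "e = {x, y}" "x \<in> W" "y \<notin> W"
      using edge_doubleton[OF sG e(1)] e(2) by (metis splits_doubleton insert_commute)
    have x: "x \<notin> ?P" "{x, p b} \<notin> edges G" using xy by (auto simp: W_def)
    have yP: "y \<notin> ?P" using at_b[of x y] x e xy by auto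
    have yV: "y \<in> verts G" using edge_subset[OF sG e(1)] xy by auto
    then have yb: "{y, p b} \<in> edges G" using yP xy by (simp add: W_def)
    have "e \<notin> ?F" using x xy by (auto simp: path_edge_def doubleton_eq_iff)
    then obtain w where w: "w \<notin> ?P" "edge_cut G e {w}" using leaf e by blast
    have "{y, p b} \<notin> ?F" using yP by (auto simp: path_edge_def doubleton_eq_iff)
    then obtain z where z: "z \<notin> ?P" "edge_cut G {y, p b} {z}" using leaf yb by blast
    have "z \<in> {y, p b}" using cut_splits[OF z(2) yb] by (auto simp: splits_def)
    then have "z = y" using z(1) b by auto
    then have "e = {y, p b}" using only[OF z(2) e(1)] xy by simp
    then have "x = p b" using xy(1) by (auto simp: doubleton_eq_iff)
    then show False using x(1) b by auto
  qed
  then have adj: "{p b, x} \<in> edges G" if "x \<in> verts G - ?P" for x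
    using that by (auto simp: W_def insert_commute)
  have "e \<in> (\<lambda>x. {p b, x}) ` (verts G - ?P)" if e: "e \<in> edges G - ?F" for e
  proof -
    obtain x where x: "x \<in> verts G - ?P" "edge_cut G e {x}" using leaf[OF e] by blast
    have "{p b, x} = e" using only[OF x(2) adj[OF x(1)]] by simp
    then show ?thesis using x(1) by auto
  qed
  then have "edges G = ?F \<union> (\<lambda>x. {p b, x}) ` (verts G - ?P)" using P(3) adj by blast
  then show ?thesis using p b by (simp add: pendants_at_def)
qed

text \<open>Here \<open>i\<close> is the index of an edge of the path, with \<open>i + 1\<close> and \<open>d - i\<close> vertices of the path on its sides. A
tie occurs only at the middle edge of a path with odd \<open>d\<close>, and decides between the two central
vertices.\<close>

lemma middle_index:
  fixes low high :: "nat \<Rightarrow> bool"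
  assumes "\<And>i. i < d \<Longrightarrow> low i \<or> high i"
    and "\<And>i. i < d \<Longrightarrow> Suc i < d - i \<Longrightarrow> low i"
    and "\<And>i. i < d \<Longrightarrow> d - i < Suc i \<Longrightarrow> high i"
  obtains b where "d \<le> 2 * b + 1" "2 * b \<le> d + 1"
    "\<forall>i<d. (i < b \<longrightarrow> low i) \<and> (b \<le> i \<longrightarrow> high i)"
proof (cases "odd d \<and> low (d div 2)")
  case True
  then have "odd d" by simp
  then have d: "d = Suc (2 * (d div 2))" by presburger
  have low: "low i" if "i < Suc (d div 2)" "i < d" for i
  proof (cases "i = d div 2")
    case False
    then show ?thesis using assms(2)[of i] that d by linarith
  qed (use True in simp)
  have high: "high i" if "Suc (d div 2) \<le> i" "i < d" for i
    using assms(3)[of i] that d by linarith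
  show thesis
    by (rule that[of "Suc (d div 2)"]) (use \<open>odd d\<close> low high in \<open>presburger | blast\<close>)+
next
  case False
  have low: "low i" if "i < d div 2" "i < d" for i
    using assms(2)[of i] that by linarith
  have high: "high i" if "d div 2 \<le> i" "i < d" for i
  proof (cases "i = d div 2 \<and> odd d")
    case True
    then show ?thesis using False assms(1)[of i] that by auto
  next
    case F: False
    then have "d - i < Suc i" using that by (cases "even d"; auto elim!: evenE oddE)
    then show ?thesis using assms(3) that by blast
  qed
  show thesis
    by (rule that[of "d div 2"]) (use low high in \<open>linarith | blast\<close>)+
qed

text \<open>In the case of equality, strict monotonicity of \<open>cut_count\<close> turns equal contributions into equal
sides. The smaller side of a path edge then has no vertices outside the path, and every other edge has
a single vertex on one side. The hypothesis \<open>2 * k + d \<le> 2 * n\<close> makes the monotonicity strict up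
to the middle edge, for which the smaller side can have \<open>(d + 1) div 2\<close> vertices.\<close>

lemma extremal_pendants_at:
  assumes G: "tree G" and p: "is_path G d p" and n: "card (verts G) = n"
    and d: "1 \<le> d" and k: "2 \<le> k" "k \<le> n - 1" "2 * k + d \<le> 2 * n"
    and eq: "steiner_wiener k G = extremal_value k d n"
  obtains b where "d \<le> 2 * b + 1" "2 * b \<le> d + 1" "pendants_at G d p b"
proof -
  have sG: "simple_graph G" using G by (rule tree_simple)
  have V: "finite (verts G)" using sG by (simp add: simple_graph_def)
  have P: "inj_on p {..d}" "p ` {..d} \<subseteq> verts G" using p by (auto simp: is_path_def)
  have dn: "d < n" using card_mono[OF V P(2)] card_image[OF P(1)] n by simp
  have "p 0 \<in> verts G" using P by auto
  then obtain side where side: "\<And>e. e \<in> edges G \<Longrightarrow> edge_cut G e (side e) \<and> p 0 \<in> side e"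
    using rooted_edge_cuts[OF G, of "p 0"] by metis
  have E: "path_edge p i \<in> edges G" if "i < d" for i using p that by (auto simp: is_path_def)
  define low where "low i \<longleftrightarrow> edge_cut G (path_edge p i) (p ` {..i})" for i
  define high where "high i \<longleftrightarrow> edge_cut G (path_edge p i) (p ` {Suc i..d})" for i
  have lh: "(low i \<or> high i) \<and> (Suc i < d - i \<longrightarrow> low i) \<and> (d - i < Suc i \<longrightarrow> high i)" if i: "i < d" for i
  proof -
    define X where "X = side (path_edge p i)"
    have X: "edge_cut G (path_edge p i) X" "p 0 \<in> X" using side E[OF i] by (auto simp: X_def)
    then have XV: "X \<subseteq> verts G" "finite X" using V finite_subset by (auto simp: edge_cut_def)
    note s = path_edge_sides[OF p X(1) i X(2)]
    note c = card_path_edge_sides[OF sG p X(1) i X(2), unfolded n]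
    have inj: "inj_on p {..i}" "inj_on p {Suc i..d}"
      using i by (auto intro!: inj_on_subset[OF P(1)])
    have low: "low i" if "card X = Suc i"
      using card_subset_eq[OF XV(2) s(1)] card_image[OF inj(1)] that X by (simp add: low_def)
    have high: "high i" if "card X = n - (d - i)"
    proof -
      have "card (verts G - X) = d - i" using XV n that dn by (simp add: card_Diff_subset)
      then have "p ` {Suc i..d} = verts G - X"
        using card_subset_eq[OF _ s(2)] V card_image[OF inj(2)] by simp
      then show ?thesis using cut_Diff[OF sG X(1)] by (simp add: high_def)
    qed
    define m where "m = min (Suc i) (d - i)"
    have "card X = m \<or> card X = n - m"
    proof (rule cut_count_eqD)
      show "cut_count n k (card X) = cut_count n k m"
        using steiner_wiener_lower_bound(2)[OF G p _ side n eq i] k by (simp add: X_def m_def)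
    qed (use c k dn in \<open>auto simp: m_def min_def\<close>)
    then consider "Suc i < d - i" "card X = Suc i \<or> card X = n - Suc i"
      | "Suc i = d - i" "card X = Suc i \<or> card X = n - (d - i)"
      | "d - i < Suc i" "card X = d - i \<or> card X = n - (d - i)"
      by (cases "Suc i" "d - i" rule: linorder_cases) (auto simp: m_def)
    then show ?thesis
    proof cases
      case 1
      \<comment> \<open>The value \<open>n - (i + 1)\<close> would leave fewer than the \<open>d - i\<close> path vertices on the far side.\<close>
      then have "card X = Suc i" using c i dn by linarith
      then show ?thesis using low 1(1) by linarith
    next
      case 2
      then show ?thesis using low high by linarith
    next
      case 3
      then have "card X = n - (d - i)" using c i dn by linarith
      then show ?thesis using high 3(1) by linarith
    qed
  qed
  have leaf: "\<exists>x \<in> verts G - p ` {..d}. edge_cut G e {x}" if e: "e \<in> edges G - path_edge p ` {..<d}" for e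
  proof -
    have X: "edge_cut G e (side e)" "p 0 \<in> side e" using side e by auto
    then have XV: "side e \<subseteq> verts G" "finite (side e)" using V finite_subset by (auto simp: edge_cut_def)
    have PX: "p ` {..d} \<subseteq> side e"
    proof
      fix x assume "x \<in> p ` {..d}"
      then obtain j where j: "j \<le> d" "x = p j" by auto
      have "path_edge p l \<noteq> e" if "l < j" for l using e that j by auto
      then show "x \<in> side e" using path_same_side[OF p X(1), of 0 j] X(2) j by auto
    qed
    then have big: "Suc d \<le> card (side e)" using card_mono[OF XV(2) PX] card_image[OF P(1)] by simp
    \<comment> \<open>The value \<open>1\<close> is impossible, since the whole path lies in \<open>side e\<close>.\<close>
    have "card (side e) = 1 \<or> card (side e) = n - 1"
    proof (rule cut_count_eqD)
      show "cut_count n k (card (side e)) = cut_count n k 1"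
        using steiner_wiener_lower_bound(3)[OF G p _ side n eq e] k by simp
    qed (use card_cut_bounds[OF sG X(1)] n k in auto)
    then have "card (verts G - side e) = 1"
      using big d dn XV n by (auto simp: card_Diff_subset)
    then obtain x where x: "verts G - side e = {x}" by (auto simp: card_1_singleton_iff)
    then show ?thesis using cut_Diff[OF sG X(1)] PX by auto
  qed
  obtain b where b: "d \<le> 2 * b + 1" "2 * b \<le> d + 1"
    "\<forall>i<d. (i < b \<longrightarrow> low i) \<and> (b \<le> i \<longrightarrow> high i)"
    using middle_index[of d low high] lh by blast
  have "b \<le> d" using b d by linarith
  then have "pendants_at G d p b"
    using b(3) leaf by (intro pendants_atI[OF G p]) (auto simp: low_def high_def)
  then show thesis using that b by blast
qed

section \<open>Centre vertices of a path\<close>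

text \<open>Along a walk in the path graph, the vertex changes by one in every step.\<close>

lemma path_graph_walk:
  assumes "walk (path_graph d) xs"
  shows "last xs + 1 \<le> hd xs + length xs" "hd xs + 1 \<le> last xs + length xs"
proof -
  have "xs \<noteq> [] \<and> successively (\<lambda>u v. u = Suc v \<or> v = Suc u) xs"
    using assms by (auto simp: walk_def path_graph_def doubleton_eq_iff elim!: successively_mono)
  then have "xs \<noteq> [] \<and> last xs + 1 \<le> hd xs + length xs \<and> hd xs + 1 \<le> last xs + length xs"
  proof (induction xs)
    case (Cons x xs)
    then show ?case by (cases xs) auto
  qed simp
  then show "last xs + 1 \<le> hd xs + length xs" "hd xs + 1 \<le> last xs + length xs" by auto
qed

lemma path_graph_dist:
  assumes "u \<le> d" "v \<le> d"
  shows "graph_dist (path_graph d) u v = (u - v) + (v - u)"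
  unfolding graph_dist_def
proof (rule Least_equality)
  have up: "walk (path_graph d) [a..<Suc b]" if "a \<le> b" "b \<le> d" for a b
    using that by (auto simp: walk_def path_graph_def successively_conv_nth simp del: upt_Suc)
  have down: "walk (path_graph d) (rev [a..<Suc b])" if "a \<le> b" "b \<le> d" for a b
    using up[OF that] by (auto simp: walk_def insert_commute simp del: upt_Suc)
  show "\<exists>xs. walk (path_graph d) xs \<and> hd xs = u \<and> last xs = v \<and> length xs = u - v + (v - u) + 1"
  proof (cases "u \<le> v")
    case True
    then show ?thesis using up[of u v] assms
      by (intro exI[of _ "[u..<Suc v]"]) (auto simp: hd_append)
  next
    case False
    then show ?thesis using down[of v u] assms
      by (intro exI[of _ "rev [v..<Suc u]"]) (auto simp: last_rev)
  qed
next
  fix m assume "\<exists>xs. walk (path_graph d) xs \<and> hd xs = u \<and> last xs = v \<and> length xs = m + 1"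
  then show "u - v + (v - u) \<le> m" using path_graph_walk[of d] by fastforce
qed

lemma centre_path_graph:
  assumes "c \<in> centre (path_graph d)"
  shows "c \<le> d" "d \<le> 2 * c + 1" "2 * c \<le> d + 1"
proof -
  have V: "verts (path_graph d) = {..d}" by (auto simp: path_graph_def)
  show c: "c \<le> d" using assms V by (auto simp: centre_def)
  have ecc: "eccentricity (path_graph d) u = max u (d - u)" if "u \<le> d" for u
    unfolding eccentricity_def V
  proof (rule Max_eqI)
    show "max u (d - u) \<in> graph_dist (path_graph d) u ` {..d}"
    proof (cases "u \<le> d - u")
      case True
      then show ?thesis using that by (intro image_eqI[of _ _ d]) (auto simp: path_graph_dist)
    next
      case False
      then show ?thesis using that by (intro image_eqI[of _ _ 0]) (auto simp: path_graph_dist)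
    qed
  qed (use that in \<open>auto simp: path_graph_dist\<close>)
  have "d div 2 \<in> verts (path_graph d)" using V by simp
  then have "eccentricity (path_graph d) c \<le> eccentricity (path_graph d) (d div 2)"
    using assms unfolding centre_def by blast
  then have "max c (d - c) \<le> max (d div 2) (d - d div 2)" using ecc c by simp
  then show "d \<le> 2 * c + 1" "2 * c \<le> d + 1" by linarith+
qed

section \<open>The minimum of the Steiner Wiener index\<close>

theorem corollary7:
  fixes T :: "'a graph" and n d k c :: nat
  assumes "2 \<le> d" and "d \<le> n - 1"
    and "tree T" and "card (verts T) = n" and "graph_diameter T = d"
    and "k \<in> {2..n - 1}"
    and "c \<in> centre (path_graph d)"
  shows "steiner_wiener k T \<ge> steiner_wiener k (T_graph d n c) \<and>
    (int k \<le> int n - \<lceil>real d / 2\<rceil> \<longrightarrow>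
      steiner_wiener k T = steiner_wiener k (T_graph d n c) \<longrightarrow>
      isomorphic T (T_graph d n c))"
proof -
  have dn: "d < n" and k: "0 < k" "2 \<le> k" "k \<le> n - 1" using assms by auto
  note c = centre_path_graph[OF assms(7)]
  have T: "steiner_wiener k (T_graph d n c) = extremal_value k d n"
    using steiner_wiener_T_graph[OF c(2,3,1) dn k(1)] .
  obtain p where p: "is_path T d p" using diameter_path[OF assms(3,5)] by blast
  have "p 0 \<in> verts T" using p by (auto simp: is_path_def)
  then obtain side where "\<And>e. e \<in> edges T \<Longrightarrow> edge_cut T e (side e) \<and> p 0 \<in> side e"
    using rooted_edge_cuts[OF assms(3), of "p 0"] by metis
  then have "steiner_wiener k (T_graph d n c) \<le> steiner_wiener k T"
    using steiner_wiener_lower_bound(1)[OF assms(3) p k(1) _ assms(4), of side] T by simp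
  moreover have "isomorphic T (T_graph d n c)"
    if kd: "int k \<le> int n - \<lceil>real d / 2\<rceil>"
      and eq: "steiner_wiener k T = steiner_wiener k (T_graph d n c)"
  proof -
    have "\<lceil>real d / 2\<rceil> \<le> int n - int k" using kd by linarith
    then have "real d / 2 \<le> of_int (int n - int k)" by (simp only: ceiling_le_iff)
    then have "2 * k + d \<le> 2 * n" by simp
    then obtain b where b: "d \<le> 2 * b + 1" "2 * b \<le> d + 1" "pendants_at T d p b"
      using extremal_pendants_at[OF assms(3) p assms(4) _ k(2,3)] assms(1) eq T by auto
    \<comment> \<open>Both are central: they agree, or they are the two middle vertices of a path with odd \<open>d\<close>.\<close>
    have "b = c \<or> d - b = c" using b c by linarith
    then have "\<exists>q. pendants_at T d q c" using b(3) pendants_at_reverse by blast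
    then show ?thesis
      using pendants_at_isomorphic[OF tree_simple[OF assms(3)] _ assms(4) dn] by blast
  qed
  ultimately show ?thesis by blast
qed

end
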